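(* For $a\in\{1,2,3\}$ let $rrg_{3,a}(m,n)$ be the number of partitions $\lambda_1\ge\lambda_2\ge\cdots\ge\lambda_m\ge 1$ of $n$ into exactly $m$ parts such that $\lambda_i\ge\lambda_{i+2}+2$ for all $1\le i\le m-2$ and the number of parts equal to $1$ is at most $a-1$, and let $$T_a(x):=\sum_{m,n\ge 0} rrg_{3,a}(m,n)\,x^m q^n .$$ Then the following identities hold: $$T_1(x)=\sum_{n,m\ge 0}\frac{q^{4\binom{m+1}{2}+2mn+\binom{n+1}{2}+n}\,x^{2m+n}}{(q^2;q^2)_m\,(q;q)_n},$$ $$T_2(x)=\sum_{n,m\ge 0}\frac{q^{4\binom{m+1}{2}+2mn+\binom{n+1}{2}}\,x^{2m+n}}{(q^2;q^2)_m\,(q;q)_n},$$ $$T_3(x)=\sum_{n,m\ge 0}\frac{q^{4\binom{m+1}{2}+2mn+\binom{n+1}{2}-2m}\,x^{2m+n}}{(q^2;q^2)_m\,(q;q)_n}.$$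
   Context: A partition of a natural number $n$ is a non-increasing sequence of positive integers (its parts) with sum $n$; the empty partition is the unique partition of $0$ and has $0$ parts. The $q$-Pochhammer symbol is $(b;q)_n=\prod_{j=0}^{n-1}(1-bq^j)$, so $(q;q)_n=\prod_{j=1}^n(1-q^j)$ and $(q^2;q^2)_m=\prod_{j=1}^m(1-q^{2j})$, with empty products equal to $1$. The identities are identities of formal power series in $x$ and $q$. *)

theory Defs
  imports "HOL-Analysis.Analysis"
begin

definition is_partition :: "nat list \<Rightarrow> nat \<Rightarrow> bool" where
  "is_partition p n \<longleftrightarrow> sorted_wrt (\<ge>) p \<and> (\<forall>k\<in>set p. 1 \<le> k) \<and> sum_list p = n"

(* Indices are shifted: p ! i is the part lambda_(i+1). *)
definition rrg3 :: "nat \<Rightarrow> nat \<Rightarrow> nat \<Rightarrow> nat" where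
  "rrg3 a m n =
     card {p. is_partition p n \<and> length p = m \<and>
              (\<forall>i. i + 2 < m \<longrightarrow> p ! i \<ge> p ! (i + 2) + 2) \<and>
              count_list p 1 \<le> a - 1}"

definition qpoch :: "'a::comm_ring_1 \<Rightarrow> 'a \<Rightarrow> nat \<Rightarrow> 'a" where
  "qpoch b q n = (\<Prod>j<n. 1 - b * q ^ j)"

text \<open>
  Power series in \<open>x\<close> and \<open>q\<close> are elements of \<open>'a fps fps\<close>: the outer variable is \<open>x\<close>, the
  coefficients are power series in \<open>q\<close>, and a series in \<open>q\<close> alone is embedded by \<^const>\<open>fps_const\<close>.
  The topology on this type is the \<open>x\<close>-adic one, so a family has a sum precisely when,
  for each \<open>k\<close>, only finitely many members have a nonzero coefficient of \<open>x ^ k\<close>, and the sum is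
  then computed coefficientwise.
\<close>

abbreviation qvar :: "'a::field fps" where "qvar \<equiv> fps_X"

abbreviation xvar :: "'a::field fps fps" where "xvar \<equiv> fps_X"

definition T :: "nat \<Rightarrow> 'a::field fps fps" where
  "T a = Abs_fps (\<lambda>m. Abs_fps (\<lambda>n. of_nat (rrg3 a m n)))"

end

theory Submission
  imports Defs
begin

text \<open>
  For a partition into positive parts, the condition \<open>\<lambda>\<^sub>i \<ge> \<lambda>\<^sub>i\<^sub>+\<^sub>2 + 2\<close> says that \<open>f\<^sub>k + f\<^sub>k\<^sub>+\<^sub>1 \<le> 2\<close> for all
  \<open>k \<ge> 1\<close>, where \<open>f\<^sub>k\<close> is the number of parts equal to \<open>k\<close>.  If such a partition has exactly \<open>j\<close> ones,
  deleting them and lowering every other part by one leaves a partition of the same kind with at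
  most \<open>2 - j\<close> ones, and every such partition arises exactly once.  Splitting by the number of ones
  therefore gives
  \<open>T\<^sub>1(x) = T\<^sub>3(xq)\<close>,
  \<open>T\<^sub>2(x) = T\<^sub>1(x) + xq T\<^sub>2(xq)\<close>,
  \<open>T\<^sub>3(x) = T\<^sub>2(x) + (xq)\<^sup>2 T\<^sub>1(xq)\<close>
  (\<open>rrg3_recurrence\<close>, \<open>T_solves_system\<close>).

  The double sums satisfy the same three equations.  The first one holds term by term.  In the
  difference of the second and the first sum the terms acquire the factor \<open>1 - q\<^sup>n\<close>, which cancels
  the last factor of \<open>(q;q)\<^sub>n\<close>; shifting \<open>n\<close> gives \<open>xq\<close> times the second sum at \<open>xq\<close>.  In the difference
  of the third and the second sum the factor is \<open>1 - q\<^sup>2\<^sup>m\<close>, which cancels in \<open>(q\<^sup>2;q\<^sup>2)\<^sub>m\<close>; shifting \<open>m\<close>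
  gives \<open>(xq)\<^sup>2\<close> times the first sum at \<open>xq\<close> (\<open>double_sum_coeff_solves_system\<close>).

  Comparing coefficients of \<open>x\<^sup>m\<close>, the system yields
  \<open>(1 - q\<^sup>m) t\<^sub>3(m) = q\<^sup>m t\<^sub>2(m - 1) + q\<^sup>m t\<^sub>1(m - 2)\<close>
  for \<open>m \<ge> 1\<close> (without the last term if \<open>m = 1\<close>), so together with the constant terms \<open>1\<close> it has only
  one solution (\<open>solves_system_unique\<close>).
\<close>

section \<open>Partitions whose parts at distance two differ by at least two\<close>

text \<open>
  Partitions of \<open>n\<close> into \<open>m\<close> parts such that any two consecutive values \<open>k, k + 1\<close> occur at most
  twice altogether.  By \<open>gap_two_iff_count_le_two\<close> below these are the partitions with
  \<open>\<lambda>\<^sub>i \<ge> \<lambda>\<^sub>i\<^sub>+\<^sub>2 + 2\<close>.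
\<close>

definition gap_partitions :: "nat \<Rightarrow> nat \<Rightarrow> nat list set" where
  "gap_partitions m n =
     {p. is_partition p n \<and> length p = m \<and> (\<forall>k\<ge>1. count_list p k + count_list p (k + 1) \<le> 2)}"

lemma count_list_two_values:
  fixes p :: "nat list"
  shows "count_list p k + count_list p (k + 1) =
    card {i. i < length p \<and> (p ! i = k \<or> p ! i = k + 1)}"
proof -
  have "count_list p k + count_list p (k + 1) = length (filter (\<lambda>x. x = k \<or> x = k + 1) p)"
    by (induction p) auto
  then show ?thesis by (simp add: length_filter_conv_card)
qed

text \<open>
  In a weakly decreasing list the positions of the values \<open>k\<close> and \<open>k + 1\<close> form an interval, so for
  some \<open>k\<close> there are three of them iff some \<open>p ! i\<close> exceeds \<open>p ! (i + 2)\<close> by at most one.  Here one can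
  take \<open>k = p ! (i + 2)\<close>, which is positive because all parts are.
\<close>

lemma gap_two_iff_count_le_two:
  assumes sorted: "sorted_wrt (\<ge>) (p :: nat list)" and pos: "\<forall>x\<in>set p. 1 \<le> x"
  shows "(\<forall>i. i + 2 < length p \<longrightarrow> p ! i \<ge> p ! (i + 2) + 2) \<longleftrightarrow>
    (\<forall>k\<ge>1. count_list p k + count_list p (k + 1) \<le> 2)"
proof
  have mono: "p ! j \<le> p ! i" if "i \<le> j" "j < length p" for i j
    using sorted that by (cases "i = j") (auto simp: sorted_wrt_iff_nth_less)
  {
    assume gap: "\<forall>i. i + 2 < length p \<longrightarrow> p ! i \<ge> p ! (i + 2) + 2"
    show "\<forall>k\<ge>1. count_list p k + count_list p (k + 1) \<le> 2"
    proof (intro allI impI)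
      fix k :: nat
      define I where "I = {i. i < length p \<and> (p ! i = k \<or> p ! i = k + 1)}"
      have fin: "finite I" by (simp add: I_def)
      have "card I \<le> 2"
      proof (cases "I = {}")
        case False
        define i where "i = Min I"
        have i: "i \<in> I" "\<And>l. l \<in> I \<Longrightarrow> i \<le> l"
          using fin False by (auto simp: i_def)
        have "I \<subseteq> {i, i + 1}"
        proof
          fix l assume l: "l \<in> I"
          show "l \<in> {i, i + 1}"
          proof (rule ccontr)
            assume "l \<notin> {i, i + 1}"
            with i(2)[OF l] have "i + 2 \<le> l" by auto
            moreover from l have "l < length p" "k \<le> p ! l" by (auto simp: I_def)
            ultimately have "k \<le> p ! (i + 2)" "i + 2 < length p"
              using mono[of "i + 2" l] by auto
            with gap have "k + 2 \<le> p ! i" by fastforce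
            with i(1) show False by (auto simp: I_def)
          qed
        qed
        from card_mono[OF _ this] show ?thesis by simp
      qed simp
      then show "count_list p k + count_list p (k + 1) \<le> 2"
        using count_list_two_values[of p k] by (simp add: I_def)
    qed
  }
  {
    assume count: "\<forall>k\<ge>1. count_list p k + count_list p (k + 1) \<le> 2"
    show "\<forall>i. i + 2 < length p \<longrightarrow> p ! i \<ge> p ! (i + 2) + 2"
    proof (intro allI impI, rule ccontr)
      fix i assume i: "i + 2 < length p" and close: "\<not> p ! i \<ge> p ! (i + 2) + 2"
      define k where "k = p ! (i + 2)"
      have "1 \<le> k" using pos i by (simp add: k_def)
      have "{i, i + 1, i + 2} \<subseteq> {l. l < length p \<and> (p ! l = k \<or> p ! l = k + 1)}"
        using i close mono[of i "i + 1"] mono[of "i + 1" "i + 2"] by (auto simp: k_def)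
      from card_mono[OF _ this] have "3 \<le> count_list p k + count_list p (k + 1)"
        unfolding count_list_two_values by simp
      with count \<open>1 \<le> k\<close> show False by fastforce
    qed
  }
qed

lemma rrg3_eq_card_gap_partitions:
  "rrg3 a m n = card {p \<in> gap_partitions m n. count_list p 1 \<le> a - 1}"
proof -
  have "{p. is_partition p n \<and> length p = m \<and>
              (\<forall>i. i + 2 < m \<longrightarrow> p ! i \<ge> p ! (i + 2) + 2) \<and> count_list p 1 \<le> a - 1}
      = {p \<in> gap_partitions m n. count_list p 1 \<le> a - 1}"
    using gap_two_iff_count_le_two unfolding gap_partitions_def is_partition_def by blast
  then show ?thesis by (simp add: rrg3_def)
qed

lemma finite_gap_partitions: "finite (gap_partitions m n)"
proof (rule finite_subset)
  show "gap_partitions m n \<subseteq> {p. set p \<subseteq> {..n} \<and> length p = m}"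
    by (auto simp: gap_partitions_def is_partition_def member_le_sum_list)
  show "finite {p. set p \<subseteq> {..n} \<and> length p = m}"
    by (rule finite_lists_length_eq) simp
qed

section \<open>Removing the ones and lowering the other parts\<close>

text \<open>
  The inverse of the removal: all parts are raised by one and \<open>j\<close> ones are appended at the end.
\<close>

definition raise :: "nat \<Rightarrow> nat list \<Rightarrow> nat list" where
  "raise j p = map Suc p @ replicate j 1"

lemma count_list_replicate: "count_list (replicate j x) y = (if x = y then j else 0)"
  by (induction j) auto

lemma count_list_raise_Suc: "count_list (raise j p) (Suc k) = count_list p k + (if k = 0 then j else 0)"
  by (simp add: raise_def count_list_map_conv count_list_replicate)

lemma sum_list_map_Suc: "sum_list (map Suc p) = sum_list p + length p"
  by (induction p) auto

lemma inj_raise: "inj (raise j)"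
  by (auto simp: inj_def raise_def)

text \<open>
  The parts of size \<open>1\<close> and \<open>2\<close> of \<open>raise j p\<close> number \<open>j\<close> plus the ones of \<open>p\<close>, so the condition at
  \<open>k = 1\<close> for \<open>raise j p\<close> bounds the ones of \<open>p\<close>, and the conditions at \<open>k + 1\<close> are those at \<open>k\<close> for
  \<open>p\<close>.  Having exactly \<open>j\<close> ones means that \<open>p\<close> has no entry \<open>0\<close>.
\<close>

lemma raise_in_gap_partitions_iff:
  assumes "j \<le> 2" "j \<le> m" "m \<le> n"
  shows "raise j p \<in> gap_partitions m n \<and> count_list (raise j p) 1 = j \<longleftrightarrow>
    p \<in> gap_partitions (m - j) (n - m) \<and> count_list p 1 \<le> (3 - j) - 1"
proof -
  have ones: "count_list (raise j p) 1 = j \<longleftrightarrow> (\<forall>x\<in>set p. 1 \<le> x)"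
  proof -
    have "count_list (raise j p) 1 = count_list p 0 + j"
      using count_list_raise_Suc[of j p 0] by simp
    then have "count_list (raise j p) 1 = j \<longleftrightarrow> 0 \<notin> set p"
      by (simp add: count_list_0_iff)
    also have "\<dots> \<longleftrightarrow> (\<forall>x\<in>set p. x \<noteq> 0)" by metis
    finally show ?thesis by (simp add: Suc_le_eq)
  qed
  have ones_sorted: "sorted_wrt (\<ge>) (replicate j (Suc 0))"
    by (induction j) auto
  have partition: "is_partition (raise j p) n \<and> length (raise j p) = m \<longleftrightarrow>
      sorted_wrt (\<ge>) p \<and> sum_list p = n - m \<and> length p = m - j"
    using assms
    by (auto simp: is_partition_def raise_def sum_list_map_Suc sum_list_replicate
        sorted_wrt_append sorted_wrt_map ones_sorted)
  have gap: "(\<forall>k\<ge>1. count_list (raise j p) k + count_list (raise j p) (k + 1) \<le> 2) \<longleftrightarrow>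
      count_list p 1 \<le> 2 - j \<and> (\<forall>k\<ge>1. count_list p k + count_list p (k + 1) \<le> 2)"
    if pos: "\<forall>x\<in>set p. 1 \<le> x"
  proof -
    have zero: "count_list p 0 = 0" using pos by (auto simp: count_list_0_iff)
    have "(\<forall>k\<ge>1. count_list (raise j p) k + count_list (raise j p) (k + 1) \<le> 2) \<longleftrightarrow>
        (\<forall>k. count_list (raise j p) (Suc k) + count_list (raise j p) (Suc (Suc k)) \<le> 2)"
      by (auto simp: Suc_le_eq gr0_conv_Suc)
    also have "\<dots> \<longleftrightarrow> (\<forall>k. count_list p k + (if k = 0 then j else 0) + count_list p (Suc k) \<le> 2)"
      by (simp add: count_list_raise_Suc)
    also have "\<dots> \<longleftrightarrow> j + count_list p 1 \<le> 2 \<and> (\<forall>k\<ge>1. count_list p k + count_list p (k + 1) \<le> 2)"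
      (is "(\<forall>k. ?Q k) \<longleftrightarrow> ?A \<and> ?B")
    proof -
      have "(\<forall>k. Q k) \<longleftrightarrow> Q 0 \<and> (\<forall>k\<ge>1. Q k)" for Q :: "nat \<Rightarrow> bool"
        by (metis One_nat_def Suc_leI neq0_conv)
      from this[of ?Q] show ?thesis using zero by simp
    qed
    finally show ?thesis using assms(1) by auto
  qed
  have "3 - j - 1 = 2 - j" by simp
  with ones partition gap show ?thesis
    unfolding gap_partitions_def is_partition_def by auto
qed

lemma raise_surj:
  assumes "sorted_wrt (\<ge>) p" "\<forall>x\<in>set p. 1 \<le> x"
  shows "\<exists>p'. p = raise (count_list p 1) p'"
  using assms
proof (induction p)
  case Nil
  then show ?case by (auto simp: raise_def)
next
  case (Cons x p)
  then obtain p' where p': "p = raise (count_list p 1) p'" by auto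
  show ?case
  proof (cases "x = 1")
    case True
    \<comment> \<open>A leading part equal to 1 forces every part to be 1.\<close>
    with Cons.prems have "\<forall>y\<in>set (x # p). y = 1" by fastforce
    then have all: "x # p = replicate (length (x # p)) 1"
      by (metis replicate_eqI)
    then have "x # p = raise (count_list (x # p) 1) []"
      by (metis append_Nil count_list_replicate list.map(1) raise_def)
    then show ?thesis by blast
  next
    case False
    with Cons.prems have "x = Suc (x - 1)" by simp
    with p' False have "x # p = raise (count_list (x # p) 1) ((x - 1) # p')"
      by (simp add: raise_def)
    then show ?thesis by blast
  qed
qed

lemma card_gap_partitions_fixed_ones:
  assumes "j \<le> 2"
  shows "card {p \<in> gap_partitions m n. count_list p 1 = j} =
    (if j \<le> m \<and> m \<le> n then rrg3 (3 - j) (m - j) (n - m) else 0)"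
proof (cases "j \<le> m \<and> m \<le> n")
  case True
  have "{p \<in> gap_partitions m n. count_list p 1 = j} =
      raise j ` {p \<in> gap_partitions (m - j) (n - m). count_list p 1 \<le> (3 - j) - 1}"
    (is "?L = raise j ` ?R")
  proof
    show "?L \<subseteq> raise j ` ?R"
    proof
      fix p assume p: "p \<in> ?L"
      then obtain p' where p': "p = raise j p'"
        using raise_surj[of p] by (auto simp: gap_partitions_def is_partition_def)
      with p raise_in_gap_partitions_iff[of j m n p'] assms True have "p' \<in> ?R" by auto
      with p' show "p \<in> raise j ` ?R" by blast
    qed
    show "raise j ` ?R \<subseteq> ?L"
      using raise_in_gap_partitions_iff[of j m n] assms True by blast
  qed
  then show ?thesis
    using True by (simp add: rrg3_eq_card_gap_partitions card_image inj_on_subset[OF inj_raise])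
next
  case False
  have "j \<le> m \<and> m \<le> n" if p: "p \<in> gap_partitions m n" "count_list p 1 = j" for p
  proof
    show "j \<le> m" using p count_le_length[of p 1] by (auto simp: gap_partitions_def)
    have "length p \<le> sum_list p" if "\<forall>x\<in>set p. 1 \<le> x"
      using that by (induction p) auto
    with p show "m \<le> n" by (auto simp: gap_partitions_def is_partition_def)
  qed
  with False have "{p \<in> gap_partitions m n. count_list p 1 = j} = {}" by blast
  then show ?thesis using False by (simp only: card.empty if_False)
qed

lemma rrg3_recurrence:
  assumes "1 \<le> a" "a \<le> 3"
  shows "rrg3 a m n = (\<Sum>j<a. if j \<le> m \<and> m \<le> n then rrg3 (3 - j) (m - j) (n - m) else 0)"
proof -
  have "{p \<in> gap_partitions m n. count_list p 1 \<le> a - 1} =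
      (\<Union>j<a. {p \<in> gap_partitions m n. count_list p 1 = j})"
    using assms by auto
  then have "rrg3 a m n = card (\<Union>j<a. {p \<in> gap_partitions m n. count_list p 1 = j})"
    by (simp add: rrg3_eq_card_gap_partitions)
  also have "\<dots> = (\<Sum>j<a. card {p \<in> gap_partitions m n. count_list p 1 = j})"
    by (rule card_UN_disjoint) (auto intro: finite_subset[OF _ finite_gap_partitions])
  also have "\<dots> = (\<Sum>j<a. if j \<le> m \<and> m \<le> n then rrg3 (3 - j) (m - j) (n - m) else 0)"
    using assms by (intro sum.cong refl card_gap_partitions_fixed_ones) auto
  finally show ?thesis .
qed

section \<open>The linear system for the generating functions\<close>

text \<open>
  The system \<open>T\<^sub>1(x) = T\<^sub>3(xq)\<close>, \<open>T\<^sub>2(x) = T\<^sub>1(x) + xq T\<^sub>2(xq)\<close>, \<open>T\<^sub>3(x) = T\<^sub>2(x) + (xq)\<^sup>2 T\<^sub>1(xq)\<close> with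
  constant terms \<open>1\<close>, written for the coefficients \<open>u a m\<close> of \<open>x\<^sup>m\<close> in \<open>T\<^sub>a\<close>: the substitution of \<open>xq\<close>
  for \<open>x\<close> multiplies the coefficient of \<open>x\<^sup>m\<close> by \<open>q\<^sup>m\<close>.
\<close>

definition solves_system :: "(nat \<Rightarrow> nat \<Rightarrow> 'a::field fps) \<Rightarrow> bool" where
  "solves_system u \<longleftrightarrow> u 1 0 = 1 \<and> u 2 0 = 1 \<and> u 3 0 = 1 \<and>
     (\<forall>m. u 1 m = qvar ^ m * u 3 m \<and>
          u 2 m = u 1 m + (if 1 \<le> m then qvar ^ m * u 2 (m - 1) else 0) \<and>
          u 3 m = u 2 m + (if 2 \<le> m then qvar ^ m * u 1 (m - 2) else 0))"

lemma solves_systemD: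
  assumes "solves_system u"
  shows "u 1 0 = 1" "u 2 0 = 1" "u 3 0 = 1"
    "u 1 m = qvar ^ m * u 3 m"
    "u 2 m = u 1 m + (if 1 \<le> m then qvar ^ m * u 2 (m - 1) else 0)"
    "u 3 m = u 2 m + (if 2 \<le> m then qvar ^ m * u 1 (m - 2) else 0)"
  using assms unfolding solves_system_def by blast+

lemma solves_system_unique:
  fixes u v :: "nat \<Rightarrow> nat \<Rightarrow> 'a::field fps"
  assumes u: "solves_system u" and v: "solves_system v"
  shows "a \<in> {1, 2, 3} \<Longrightarrow> u a m = v a m"
proof (induction m arbitrary: a rule: less_induct)
  case (less m)
  note U = solves_systemD[OF u] and V = solves_systemD[OF v]
  show ?case
  proof (cases "m = 0")
    case True
    with less.prems U(1-3) V(1-3) show ?thesis by auto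
  next
    case False
    \<comment> \<open>Eliminating \<open>u 1 m\<close> and \<open>u 2 m\<close> gives \<open>u 3 m = q ^ m * u 3 m + g\<close>, where \<open>g\<close> depends on
      earlier coefficients only.\<close>
    define g where "g = qvar ^ m * u 2 (m - 1) + (if 2 \<le> m then qvar ^ m * u 1 (m - 2) else 0)"
    have g': "g = qvar ^ m * v 2 (m - 1) + (if 2 \<le> m then qvar ^ m * v 1 (m - 2) else 0)"
      using False less.IH[of "m - 1" 2] less.IH[of "m - 2" 1] by (auto simp: g_def)
    have eqs: "u 3 m = qvar ^ m * u 3 m + g" "v 3 m = qvar ^ m * v 3 m + g"
    proof -
      have "1 \<le> m" using False by simp
      then show "u 3 m = qvar ^ m * u 3 m + g"
        by (subst U(6), subst U(5), subst U(4)) (simp only: g_def if_True add.assoc)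
      from \<open>1 \<le> m\<close> show "v 3 m = qvar ^ m * v 3 m + g"
        by (subst V(6), subst V(5), subst V(4)) (simp only: g' if_True add.assoc)
    qed
    have "(1 - qvar ^ m) * (u 3 m - v 3 m) =
        (u 3 m - qvar ^ m * u 3 m) - (v 3 m - qvar ^ m * v 3 m)"
      by (simp add: algebra_simps)
    also have "\<dots> = g - g"
      using eqs by (metis add_diff_cancel_left')
    finally have "(1 - qvar ^ m) * (u 3 m - v 3 m) = 0"
      by simp
    \<comment> \<open>Since \<open>m\<close> is positive, \<open>1 - q ^ m\<close> is not zero and can be cancelled.\<close>
    moreover have "(1 - qvar ^ m :: 'a fps) \<noteq> 0"
    proof -
      have "fps_nth (1 - qvar ^ m :: 'a fps) 0 = 1" using False by simp
      then show ?thesis by (metis fps_zero_nth zero_neq_one)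
    qed
    ultimately have 3: "u 3 m = v 3 m" by simp
    then have 1: "u 1 m = v 1 m" using U(4) V(4) by metis
    have 2: "u 2 m = v 2 m"
      unfolding U(5)[of m] V(5)[of m] using False less.IH[of "m - 1" 2] 1 by simp
    from 1 2 3 less.prems show ?thesis by auto
  qed
qed

lemma T_nth_0: "fps_nth (T a :: 'a::field fps fps) 0 = 1"
proof -
  have "{p \<in> gap_partitions 0 n. count_list p 1 \<le> a - 1} = (if n = 0 then {[]} else {})" for n
    by (auto simp: gap_partitions_def is_partition_def)
  then have "rrg3 a 0 n = (if n = 0 then 1 else 0)" for n
    unfolding rrg3_eq_card_gap_partitions by simp
  then show ?thesis by (simp add: T_def fps_eq_iff)
qed

lemma T_nth_recurrence:
  assumes "1 \<le> a" "a \<le> 3"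
  shows "fps_nth (T a :: 'a::field fps fps) m =
    (\<Sum>j<a. if j \<le> m then qvar ^ m * fps_nth (T (3 - j)) (m - j) else 0)"
proof (rule fps_ext)
  fix n
  have "fps_nth (fps_nth (T a :: 'a fps fps) m) n =
      (\<Sum>j<a. of_nat (if j \<le> m \<and> m \<le> n then rrg3 (3 - j) (m - j) (n - m) else 0))"
    using rrg3_recurrence[of a m n] assms by (simp add: T_def)
  also have "\<dots> = (\<Sum>j<a. fps_nth (if j \<le> m then qvar ^ m * fps_nth (T (3 - j)) (m - j) else 0) n)"
    by (intro sum.cong refl) (auto simp: T_def fps_X_power_mult_nth)
  finally show "fps_nth (fps_nth (T a :: 'a fps fps) m) n =
      fps_nth (\<Sum>j<a. if j \<le> m then qvar ^ m * fps_nth (T (3 - j)) (m - j) else 0) n"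
    by (simp add: fps_sum_nth)
qed

lemma T_solves_system: "solves_system (\<lambda>a m. fps_nth (T a :: 'a::field fps fps) m)"
proof -
  define g :: "nat \<Rightarrow> nat \<Rightarrow> 'a fps" where
    "g j m = (if j \<le> m then qvar ^ m * fps_nth (T (3 - j)) (m - j) else 0)" for j m
  have rec: "fps_nth (T a) m = (\<Sum>j<a. g j m)" if "1 \<le> a" "a \<le> 3" for a m
    unfolding g_def by (rule T_nth_recurrence[OF that])
  have step: "fps_nth (T (Suc a)) m = fps_nth (T a) m + g a m" if "1 \<le> a" "a \<le> 2" for a m
    using that by (simp add: rec)
  have "fps_nth (T 1) m = qvar ^ m * (fps_nth (T 3) m :: 'a fps)" for m
    using rec[of 1 m] by (simp add: g_def)
  moreover have "fps_nth (T 2) m = fps_nth (T 1) m +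
      (if 1 \<le> m then qvar ^ m * (fps_nth (T 2) (m - 1) :: 'a fps) else 0)" for m
    using step[of 1 m] unfolding g_def by (simp add: eval_nat_numeral)
  moreover have "fps_nth (T 3) m = fps_nth (T 2) m +
      (if 2 \<le> m then qvar ^ m * (fps_nth (T 1) (m - 2) :: 'a fps) else 0)" for m
    using step[of 2 m] unfolding g_def by (simp add: eval_nat_numeral)
  ultimately show ?thesis
    unfolding solves_system_def by (intro conjI allI T_nth_0)
qed

section \<open>The double sums\<close>

text \<open>
  The exponent of \<open>q\<close> in the numerator of the \<open>(n, m)\<close> term of the \<open>a\<close>-th double sum.  The subtraction
  on the natural numbers never truncates, by \<open>two_mult_le_four_choose_two\<close>.
\<close>

definition term_exponent :: "nat \<Rightarrow> nat \<Rightarrow> nat \<Rightarrow> nat" where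
  "term_exponent a n m = 4 * ((m + 1) choose 2) + 2 * m * n + ((n + 1) choose 2)
     + (if a = 1 then n else 0) - (if a = 3 then 2 * m else 0)"

text \<open>The power series in \<open>q\<close> that multiplies \<open>x ^ (2 * m + n)\<close> in the \<open>a\<close>-th double sum.\<close>

definition term_coeff :: "nat \<Rightarrow> nat \<Rightarrow> nat \<Rightarrow> 'a::field fps" where
  "term_coeff a n m = qvar ^ term_exponent a n m / (qpoch (qvar ^ 2) (qvar ^ 2) m * qpoch qvar qvar n)"

lemma choose_two_Suc: "(Suc n choose 2) = (n choose 2) + n"
  by (simp add: numeral_2_eq_2)

lemma two_mult_le_four_choose_two: "2 * m \<le> 4 * ((m + 1) choose 2)"
  by (cases m) (simp_all add: choose_two_Suc)

lemma term_exponent_1: "term_exponent 1 n m = (2 * m + n) + term_exponent 3 n m"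
  using two_mult_le_four_choose_two[of m] by (simp add: term_exponent_def)

lemma term_exponent_1_eq_2: "term_exponent 1 n m = term_exponent 2 n m + n"
  by (simp add: term_exponent_def)

lemma term_exponent_2_eq_3: "term_exponent 2 n m = term_exponent 3 n m + 2 * m"
  using two_mult_le_four_choose_two[of m] by (simp add: term_exponent_def)

lemma term_exponent_2_Suc: "term_exponent 2 (Suc n) m = (2 * m + Suc n) + term_exponent 2 n m"
  by (simp add: term_exponent_def choose_two_Suc)

lemma term_exponent_3_Suc: "term_exponent 3 n (Suc m) = (2 * Suc m + n) + term_exponent 1 n m"
  by (simp add: term_exponent_def choose_two_Suc)

lemma qpoch_0: "qpoch b q 0 = 1"
  by (simp add: qpoch_def)

lemma qpoch_Suc: "qpoch b q (Suc n) = qpoch b q n * (1 - b * q ^ n)"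
  by (simp add: qpoch_def)

lemma qpoch_nth_0:
  fixes b q :: "'a::field fps"
  assumes "fps_nth b 0 = 0"
  shows "fps_nth (qpoch b q n) 0 = 1"
  using assms by (induction n) (simp_all add: qpoch_def)

lemma divide_cancel_unit:
  fixes f g h :: "'a::field fps"
  assumes "fps_nth g 0 \<noteq> 0" "fps_nth h 0 \<noteq> 0"
  shows "f * h / (g * h) = f / g"
  using assms
  by (simp add: fps_divide_unit fps_inverse_mult mult.assoc mult.left_commute inverse_mult_eq_1')

lemma qpoch_denom_nth_0:
  "fps_nth (qpoch (qvar ^ 2) (qvar ^ 2) m * qpoch qvar qvar n :: 'a::field fps) 0 \<noteq> 0"
  by (simp add: qpoch_nth_0)

lemma term_coeff_1: "term_coeff 1 n m = qvar ^ (2 * m + n) * term_coeff 3 n m"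
  by (simp only: term_coeff_def term_exponent_1 power_add fps_divide_unit[OF qpoch_denom_nth_0]
      mult.assoc)

lemma term_coeff_2_0: "term_coeff 2 0 m = term_coeff 1 0 m"
  by (simp only: term_coeff_def term_exponent_1_eq_2 add_0_right)

text \<open>
  The difference of the two coefficients carries the factor \<open>1 - q ^ (n + 1)\<close>, the last factor of
  \<open>qpoch q q (n + 1)\<close>.
\<close>

lemma term_coeff_2_Suc:
  "(term_coeff 2 (Suc n) m :: 'a::field fps) =
     term_coeff 1 (Suc n) m + qvar ^ (2 * m + Suc n) * term_coeff 2 n m"
proof -
  let ?D = "qpoch (qvar ^ 2) (qvar ^ 2) m * qpoch qvar qvar n :: 'a fps"
  let ?h = "1 - qvar ^ Suc n :: 'a fps"
  have D: "qpoch (qvar ^ 2) (qvar ^ 2) m * qpoch qvar qvar (Suc n) = ?D * ?h"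
    by (simp add: qpoch_Suc mult.assoc)
  have "term_coeff 2 (Suc n) m - term_coeff 1 (Suc n) m =
      (qvar ^ term_exponent 2 (Suc n) m * ?h) / (?D * ?h)"
    unfolding term_coeff_def D term_exponent_1_eq_2[of "Suc n" m]
    by (simp add: fps_divide_unit qpoch_nth_0 power_add algebra_simps)
  also have "\<dots> = qvar ^ term_exponent 2 (Suc n) m / ?D"
    by (rule divide_cancel_unit) (simp_all add: qpoch_nth_0)
  also have "\<dots> = qvar ^ (2 * m + Suc n) * term_coeff 2 n m"
    unfolding term_coeff_def term_exponent_2_Suc power_add fps_divide_unit[OF qpoch_denom_nth_0]
    by (simp only: mult.assoc)
  finally show ?thesis by (simp add: algebra_simps)
qed

lemma term_coeff_3_0: "term_coeff 3 n 0 = term_coeff 2 n 0"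
  by (simp add: term_coeff_def term_exponent_2_eq_3)

text \<open>
  Here the factor is \<open>1 - q ^ (2 * (m + 1))\<close>, the last factor of \<open>qpoch (q ^ 2) (q ^ 2) (m + 1)\<close>.
\<close>

lemma term_coeff_3_Suc:
  "(term_coeff 3 n (Suc m) :: 'a::field fps) =
     term_coeff 2 n (Suc m) + qvar ^ (2 * Suc m + n) * term_coeff 1 n m"
proof -
  let ?D = "qpoch (qvar ^ 2) (qvar ^ 2) m * qpoch qvar qvar n :: 'a fps"
  let ?h = "1 - qvar ^ (2 * Suc m) :: 'a fps"
  have D: "qpoch (qvar ^ 2) (qvar ^ 2) (Suc m) * qpoch qvar qvar n = ?D * ?h"
    unfolding qpoch_Suc power_mult power_Suc[of "qvar ^ 2"] by (simp only: mult_ac)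
  have "term_coeff 3 n (Suc m) - term_coeff 2 n (Suc m) =
      (qvar ^ term_exponent 3 n (Suc m) * ?h) / (?D * ?h)"
    unfolding term_coeff_def D term_exponent_2_eq_3[of n "Suc m"]
    by (simp add: fps_divide_unit qpoch_nth_0 power_add algebra_simps)
  also have "\<dots> = qvar ^ term_exponent 3 n (Suc m) / ?D"
    by (rule divide_cancel_unit) (simp_all add: qpoch_nth_0)
  also have "\<dots> = qvar ^ (2 * Suc m + n) * term_coeff 1 n m"
    unfolding term_coeff_def term_exponent_3_Suc power_add fps_divide_unit[OF qpoch_denom_nth_0]
    by (simp only: mult.assoc)
  finally show ?thesis by (simp add: algebra_simps)
qed

text \<open>The indices of the terms that contribute to the coefficient of \<open>x ^ k\<close>.\<close>

definition weight_pairs :: "nat \<Rightarrow> (nat \<times> nat) set" where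
  "weight_pairs k = {(n, m). 2 * m + n = k}"

lemma finite_weight_pairs [simp]: "finite (weight_pairs k)"
  by (rule finite_subset[of _ "{..k} \<times> {..k}"]) (auto simp: weight_pairs_def)

lemma sum_weight_pairs_shift_n:
  fixes f :: "nat \<Rightarrow> nat \<Rightarrow> 'b::comm_monoid_add"
  assumes "\<And>m. f 0 m = 0"
  shows "(\<Sum>(n, m)\<in>weight_pairs k. f n m) =
    (if 1 \<le> k then \<Sum>(n, m)\<in>weight_pairs (k - 1). f (Suc n) m else 0)"
proof -
  have "(\<Sum>(n, m)\<in>weight_pairs k. f n m) = (\<Sum>(n, m)\<in>{(n, m)\<in>weight_pairs k. 1 \<le> n}. f n m)"
    using assms by (intro sum.mono_neutral_right) (auto simp: Suc_le_eq intro!: gr0I)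
  also have "\<dots> = (if 1 \<le> k then \<Sum>(n, m)\<in>weight_pairs (k - 1). f (Suc n) m else 0)"
  proof (cases "1 \<le> k")
    case True
    have "(\<Sum>(n, m)\<in>{(n, m)\<in>weight_pairs k. 1 \<le> n}. f n m) =
        (\<Sum>(n, m)\<in>weight_pairs (k - 1). f (Suc n) m)"
      by (rule sum.reindex_bij_witness[where i = "\<lambda>(n, m). (Suc n, m)" and j = "\<lambda>(n, m). (n - 1, m)"])
        (use True in \<open>auto simp: weight_pairs_def\<close>)
    with True show ?thesis by simp
  next
    case False
    then have "{(n, m)\<in>weight_pairs k. 1 \<le> n} = {}" by (auto simp: weight_pairs_def)
    then show ?thesis using False by (simp only: sum.empty if_False)
  qed
  finally show ?thesis .
qed

lemma sum_weight_pairs_shift_m: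
  fixes f :: "nat \<Rightarrow> nat \<Rightarrow> 'b::comm_monoid_add"
  assumes "\<And>n. f n 0 = 0"
  shows "(\<Sum>(n, m)\<in>weight_pairs k. f n m) =
    (if 2 \<le> k then \<Sum>(n, m)\<in>weight_pairs (k - 2). f n (Suc m) else 0)"
proof -
  have "(\<Sum>(n, m)\<in>weight_pairs k. f n m) = (\<Sum>(n, m)\<in>{(n, m)\<in>weight_pairs k. 1 \<le> m}. f n m)"
    using assms by (intro sum.mono_neutral_right) (auto simp: Suc_le_eq intro!: gr0I)
  also have "\<dots> = (if 2 \<le> k then \<Sum>(n, m)\<in>weight_pairs (k - 2). f n (Suc m) else 0)"
  proof (cases "2 \<le> k")
    case True
    have "(\<Sum>(n, m)\<in>{(n, m)\<in>weight_pairs k. 1 \<le> m}. f n m) =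
        (\<Sum>(n, m)\<in>weight_pairs (k - 2). f n (Suc m))"
      by (rule sum.reindex_bij_witness[where i = "\<lambda>(n, m). (n, Suc m)" and j = "\<lambda>(n, m). (n, m - 1)"])
        (use True in \<open>auto simp: weight_pairs_def\<close>)
    with True show ?thesis by simp
  next
    case False
    then have "{(n, m)\<in>weight_pairs k. 1 \<le> m} = {}" by (auto simp: weight_pairs_def)
    then show ?thesis using False by (simp only: sum.empty if_False)
  qed
  finally show ?thesis .
qed

text \<open>The coefficient of \<open>x ^ k\<close> in the \<open>a\<close>-th double sum.\<close>

definition double_sum_coeff :: "nat \<Rightarrow> nat \<Rightarrow> 'a::field fps" where
  "double_sum_coeff a k = (\<Sum>(n, m)\<in>weight_pairs k. term_coeff a n m)"

lemma double_sum_coeff_solves_system: "solves_system (double_sum_coeff :: nat \<Rightarrow> nat \<Rightarrow> 'a::field fps)"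
  unfolding solves_system_def
proof (intro conjI allI)
  have "weight_pairs 0 = {(0, 0)}" by (auto simp: weight_pairs_def)
  then show "double_sum_coeff 1 0 = (1 :: 'a fps)" "double_sum_coeff 2 0 = (1 :: 'a fps)"
    "double_sum_coeff 3 0 = (1 :: 'a fps)"
    by (simp_all add: double_sum_coeff_def term_coeff_def term_exponent_def qpoch_0 binomial_eq_0)
  fix k
  show "double_sum_coeff 1 k = qvar ^ k * (double_sum_coeff 3 k :: 'a fps)"
    unfolding double_sum_coeff_def sum_distrib_left term_coeff_1
    by (intro sum.cong) (auto simp: weight_pairs_def)
  have "double_sum_coeff 2 k - double_sum_coeff 1 k =
      (\<Sum>(n, m)\<in>weight_pairs k. term_coeff 2 n m - term_coeff 1 n m :: 'a fps)"
    by (simp add: double_sum_coeff_def sum_subtractf case_prod_unfold)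
  also have "\<dots> = (if 1 \<le> k then \<Sum>(n, m)\<in>weight_pairs (k - 1).
      term_coeff 2 (Suc n) m - term_coeff 1 (Suc n) m else 0)"
    by (rule sum_weight_pairs_shift_n) (simp add: term_coeff_2_0)
  also have "\<dots> = (if 1 \<le> k then qvar ^ k * double_sum_coeff 2 (k - 1) else 0)"
  proof (cases "1 \<le> k")
    case True
    then have "2 * m + Suc n = k" if "(n, m) \<in> weight_pairs (k - 1)" for n m
      using that by (simp add: weight_pairs_def)
    then show ?thesis
      unfolding double_sum_coeff_def sum_distrib_left term_coeff_2_Suc
      by (auto intro!: sum.cong simp del: add_Suc_right)
  qed simp
  finally show "double_sum_coeff 2 k = double_sum_coeff 1 k +
      (if 1 \<le> k then qvar ^ k * (double_sum_coeff 2 (k - 1) :: 'a fps) else 0)"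
    by (simp add: algebra_simps)
  have "double_sum_coeff 3 k - double_sum_coeff 2 k =
      (\<Sum>(n, m)\<in>weight_pairs k. term_coeff 3 n m - term_coeff 2 n m :: 'a fps)"
    by (simp add: double_sum_coeff_def sum_subtractf case_prod_unfold)
  also have "\<dots> = (if 2 \<le> k then \<Sum>(n, m)\<in>weight_pairs (k - 2).
      term_coeff 3 n (Suc m) - term_coeff 2 n (Suc m) else 0)"
    by (rule sum_weight_pairs_shift_m) (simp add: term_coeff_3_0)
  also have "\<dots> = (if 2 \<le> k then qvar ^ k * double_sum_coeff 1 (k - 2) else 0)"
  proof (cases "2 \<le> k")
    case True
    then have "2 * Suc m + n = k" if "(n, m) \<in> weight_pairs (k - 2)" for n m
      using that by (simp add: weight_pairs_def)
    then show ?thesis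
      unfolding double_sum_coeff_def sum_distrib_left term_coeff_3_Suc
      by (auto intro!: sum.cong simp del: mult_Suc_right)
  qed simp
  finally show "double_sum_coeff 3 k = double_sum_coeff 2 k +
      (if 2 \<le> k then qvar ^ k * (double_sum_coeff 1 (k - 2) :: 'a fps) else 0)"
    by (simp add: algebra_simps)
qed

lemma T_has_sum:
  assumes "a \<in> {1, 2, 3}"
  shows "((\<lambda>(n, m). fps_const (term_coeff a n m) * xvar ^ (2 * m + n)) has_sum
    (T a :: 'a::field fps fps)) UNIV"
    (is "(?f has_sum _) _")
proof (rule has_sum_fpsI)
  fix k
  have nth: "fps_nth (?f (n, m)) k = (if (n, m) \<in> weight_pairs k then term_coeff a n m else 0)" for n m
    by (auto simp: weight_pairs_def fps_X_power_nth)
  then have sub: "{i \<in> UNIV. fps_nth (?f i) k \<noteq> 0} \<subseteq> weight_pairs k"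
    by (auto simp only: mem_Collect_eq split: if_splits)
  then show "finite {i \<in> UNIV. fps_nth (?f i) k \<noteq> 0}"
    by (rule finite_subset) simp
  have "fps_nth (T a :: 'a fps fps) k = double_sum_coeff a k"
    using solves_system_unique[OF T_solves_system double_sum_coeff_solves_system assms] .
  also have "\<dots> = (\<Sum>i\<in>weight_pairs k. fps_nth (?f i) k)"
    unfolding double_sum_coeff_def
  proof (intro sum.cong refl)
    fix i assume i: "i \<in> weight_pairs k"
    obtain n m where "i = (n, m)" by (cases i)
    with i nth[of n m] show "(case i of (n, m) \<Rightarrow> term_coeff a n m) = fps_nth (?f i) k" by simp
  qed
  also have "\<dots> = (\<Sum>i | i \<in> UNIV \<and> fps_nth (?f i) k \<noteq> 0. fps_nth (?f i) k)"
    by (rule sum.mono_neutral_right) (use sub in auto)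
  finally show "fps_nth (T a :: 'a fps fps) k =
    (\<Sum>i | i \<in> UNIV \<and> fps_nth (?f i) k \<noteq> 0. fps_nth (?f i) k)" .
qed

theorem theorem1p6:
  shows
    "((\<lambda>(n, m).
        fps_const (qvar ^ (4 * ((m + 1) choose 2) + 2 * m * n + ((n + 1) choose 2) + n)
                   / (qpoch (qvar ^ 2) (qvar ^ 2) m * qpoch qvar qvar n)) * xvar ^ (2 * m + n))
      has_sum (T 1 :: 'a::field fps fps)) (UNIV :: (nat \<times> nat) set) \<and>
     ((\<lambda>(n, m).
        fps_const (qvar ^ (4 * ((m + 1) choose 2) + 2 * m * n + ((n + 1) choose 2))
                   / (qpoch (qvar ^ 2) (qvar ^ 2) m * qpoch qvar qvar n)) * xvar ^ (2 * m + n))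
      has_sum (T 2 :: 'a::field fps fps)) (UNIV :: (nat \<times> nat) set) \<and>
     ((\<lambda>(n, m).
        fps_const (qvar ^ (4 * ((m + 1) choose 2) + 2 * m * n + ((n + 1) choose 2) - 2 * m)
                   / (qpoch (qvar ^ 2) (qvar ^ 2) m * qpoch qvar qvar n)) * xvar ^ (2 * m + n))
      has_sum (T 3 :: 'a::field fps fps)) (UNIV :: (nat \<times> nat) set)"
  using T_has_sum[of 1] T_has_sum[of 2] T_has_sum[of 3]
  unfolding term_coeff_def term_exponent_def by simp

end
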